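(* Let $n\geq 4$ with $n\neq 5$, let $G_n=\mathbb{Z}_n\times\mathbb{Z}_n$, let $S=\{(i,0),(0,i),(i,i): 1\leq i\leq n-1\}\subset G_n$, and let $\Gamma(n)=\mathrm{Cay}(G_n;S)$ (vertices $G_n$, $g\sim h$ iff $h-g\in S$). Then $\Gamma(n)$ is not distance-transitive.
   Context: A graph $\Gamma$ is distance-transitive if for all vertices $u,v,x,y$ with $d(u,v)=d(x,y)$ (graph distance) there is an automorphism $\pi$ of $\Gamma$ with $\pi(u)=x$ and $\pi(v)=y$. *)

theory Defs
  imports "Graph_Theory.Graph_Theory" "HOL-Algebra.Elementary_Groups"
begin

text \<open>
  Undirected graphs are symmetric digraphs, as in the locale \<open>graph\<close>; the distance is the
  shortest-path distance with all arc weights equal to 1.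
\<close>

definition graph_dist :: "('a, 'b) pre_digraph \<Rightarrow> 'a \<Rightarrow> 'a \<Rightarrow> ereal" where
  "graph_dist \<Gamma> = wf_digraph.\<mu> \<Gamma> (\<lambda>_. 1)"

definition digraph_automorphism ::
    "('a, 'b) pre_digraph \<Rightarrow> ('a, 'b, 'a, 'b) digraph_isomorphism \<Rightarrow> bool" where
  "digraph_automorphism \<Gamma> \<pi> \<longleftrightarrow> pre_digraph.digraph_isomorphism \<Gamma> \<pi> \<and> app_iso \<pi> \<Gamma> = \<Gamma>"

definition distance_transitive :: "('a, 'b) pre_digraph \<Rightarrow> bool" where
  "distance_transitive \<Gamma> \<longleftrightarrow>
    (\<forall>u\<in>verts \<Gamma>. \<forall>v\<in>verts \<Gamma>. \<forall>x\<in>verts \<Gamma>. \<forall>y\<in>verts \<Gamma>.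
       graph_dist \<Gamma> u v = graph_dist \<Gamma> x y \<longrightarrow>
       (\<exists>\<pi>. digraph_automorphism \<Gamma> \<pi> \<and> iso_verts \<pi> u = x \<and> iso_verts \<pi> v = y))"

text \<open>In multiplicative notation, the difference \<open>h - g\<close> becomes \<open>h \<otimes> inv g\<close>.\<close>

definition cayley_graph :: "('a, 'c) monoid_scheme \<Rightarrow> 'a set \<Rightarrow> ('a, 'a \<times> 'a) pre_digraph" where
  "cayley_graph G S = with_proj
     \<lparr> pverts = carrier G,
       parcs = {(g, h). g \<in> carrier G \<and> h \<in> carrier G \<and> h \<otimes>\<^bsub>G\<^esub> inv\<^bsub>G\<^esub> g \<in> S} \<rparr>"

definition Zn_square :: "nat \<Rightarrow> (int \<times> int) monoid" where
  "Zn_square n = integer_mod_group n \<times>\<times> integer_mod_group n"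

text \<open>For \<open>n > 0\<close> the carrier of \<open>integer_mod_group n\<close> is \<open>{0..<int n}\<close>.\<close>

definition conn_set :: "nat \<Rightarrow> (int \<times> int) set" where
  "conn_set n = (\<Union>i\<in>{1..int n - 1}. {(i, 0), (0, i), (i, i)})"

definition Gamma :: "nat \<Rightarrow> (int \<times> int, (int \<times> int) \<times> (int \<times> int)) pre_digraph" where
  "Gamma n = cayley_graph (Zn_square n) (conn_set n)"

text \<open>
  For graphs whose arcs are vertex pairs, the vertex maps of automorphisms are exactly the
  adjacency-preserving permutations of the vertices.
\<close>

lemma digraph_automorphism_with_proj:
  assumes "wf_digraph (with_proj P)"
  shows "(\<exists>\<pi>. digraph_automorphism (with_proj P) \<pi> \<and> iso_verts \<pi> = f) \<longleftrightarrow>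
    bij_betw f (pverts P) (pverts P) \<and>
    (\<forall>u\<in>pverts P. \<forall>v\<in>pverts P. (u, v) \<in> parcs P \<longleftrightarrow> (f u, f v) \<in> parcs P)"
    (is "?L \<longleftrightarrow> ?R")
proof
  have wf: "u \<in> pverts P" "v \<in> pverts P" if "(u, v) \<in> parcs P" for u v
    using assms that by (auto simp: wf_digraph_def)
  show ?R if ?L
  proof -
    from that obtain \<pi> where iso: "pre_digraph.digraph_isomorphism (with_proj P) \<pi>"
      and app: "app_iso \<pi> (with_proj P) = with_proj P" and f: "iso_verts \<pi> = f"
      by (auto simp: digraph_automorphism_def)
    have V: "f ` pverts P = pverts P"
      using arg_cong[OF app, of verts] f by simp
    have inj: "inj_on f (pverts P)"
      using iso f by (simp add: pre_digraph.digraph_isomorphism_def)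
    have A: "parcs P = (\<lambda>(u, v). (f u, f v)) ` parcs P"
      using wf_digraph.arcs_ends_app_iso_eq[OF assms iso] by (simp only: app f with_proj_simps)
    have "(u, v) \<in> parcs P \<longleftrightarrow> (f u, f v) \<in> parcs P" if "u \<in> pverts P" "v \<in> pverts P" for u v
    proof
      show "(f u, f v) \<in> parcs P" if "(u, v) \<in> parcs P"
        using that by (subst A) force
    next
      assume "(f u, f v) \<in> parcs P"
      then have "(f u, f v) \<in> (\<lambda>(u, v). (f u, f v)) ` parcs P"
        by (subst A[symmetric])
      then obtain a b where "(a, b) \<in> parcs P" "f u = f a" "f v = f b"
        by auto
      with wf inj that show "(u, v) \<in> parcs P"
        by (metis inj_onD)
    qed
    with V inj show ?thesis by (auto simp: bij_betw_def)
  qed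
  show ?L if R: ?R
  proof -
    let ?h = "\<lparr>iso_verts = f, iso_arcs = \<lambda>(u, v). (f u, f v), iso_head = snd, iso_tail = fst\<rparr>"
    from R have inj: "inj_on f (pverts P)" and V: "f ` pverts P = pverts P"
      and adj: "\<And>u v. u \<in> pverts P \<Longrightarrow> v \<in> pverts P \<Longrightarrow> (u, v) \<in> parcs P \<longleftrightarrow> (f u, f v) \<in> parcs P"
      by (simp_all only: bij_betw_def)
    have "inj_on (\<lambda>(u, v). (f u, f v)) (parcs P)"
      using wf inj by (auto intro!: inj_onI dest: inj_onD)
    moreover have "(\<lambda>(u, v). (f u, f v)) ` parcs P = parcs P"
    proof (intro equalityI subsetI)
      fix e assume "e \<in> (\<lambda>(u, v). (f u, f v)) ` parcs P"
      then obtain u v where "(u, v) \<in> parcs P" "e = (f u, f v)" by auto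
      with wf[of u v] adj[of u v] show "e \<in> parcs P" by blast
    next
      fix e assume e: "e \<in> parcs P"
      obtain x y where xy: "e = (x, y)" by (cases e)
      with e wf have "x \<in> f ` pverts P" "y \<in> f ` pverts P" using V by auto
      then obtain u v where uv: "u \<in> pverts P" "v \<in> pverts P" "x = f u" "y = f v" by auto
      with e xy adj[of u v] have "(u, v) \<in> parcs P" by blast
      with uv xy show "e \<in> (\<lambda>(u, v). (f u, f v)) ` parcs P" by (auto intro: rev_image_eqI)
    qed
    ultimately have "digraph_automorphism (with_proj P) ?h"
      using assms inj V
      by (auto simp: digraph_automorphism_def pre_digraph.digraph_isomorphism_def app_iso_def
          with_proj_def)
    then show ?L by (intro exI[of _ ?h]) simp
  qed
qed

lemma graph_cayley_graph:
  assumes "group G" "finite (carrier G)" "\<one>\<^bsub>G\<^esub> \<notin> S"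
    and "\<And>s. s \<in> S \<Longrightarrow> s \<in> carrier G \<Longrightarrow> inv\<^bsub>G\<^esub> s \<in> S"
  shows "graph (cayley_graph G S)"
proof -
  interpret group G by fact
  let ?A = "{(g, h). g \<in> carrier G \<and> h \<in> carrier G \<and> h \<otimes>\<^bsub>G\<^esub> inv\<^bsub>G\<^esub> g \<in> S}"
  have "finite ?A"
    by (rule finite_subset[of _ "carrier G \<times> carrier G"]) (use assms(2) in auto)
  moreover have "g \<otimes>\<^bsub>G\<^esub> inv\<^bsub>G\<^esub> h \<in> S"
    if "g \<in> carrier G" "h \<in> carrier G" "h \<otimes>\<^bsub>G\<^esub> inv\<^bsub>G\<^esub> g \<in> S" for g h
  proof -
    have "inv\<^bsub>G\<^esub> (h \<otimes>\<^bsub>G\<^esub> inv\<^bsub>G\<^esub> g) = g \<otimes>\<^bsub>G\<^esub> inv\<^bsub>G\<^esub> h"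
      using that by (simp add: inv_mult_group)
    with assms(4)[OF that(3)] that show ?thesis by simp
  qed
  ultimately show ?thesis
    using assms(2,3) unfolding cayley_graph_def
    by unfold_locales (auto simp: symmetric_def sym_def arc_to_ends_def)
qed

lemma graph_Gamma:
  assumes "0 < n"
  shows "graph (Gamma n)"
proof -
  have gr: "group (Zn_square n)"
    unfolding Zn_square_def by (simp add: DirProd_group)
  show ?thesis
    unfolding Gamma_def
  proof (rule graph_cayley_graph[OF gr])
    show "finite (carrier (Zn_square n))"
      using assms by (simp add: Zn_square_def DirProd_def carrier_integer_mod_group)
    show "\<one>\<^bsub>Zn_square n\<^esub> \<notin> conn_set n"
      by (auto simp: Zn_square_def DirProd_def conn_set_def)
    fix s assume "s \<in> conn_set n" "s \<in> carrier (Zn_square n)"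
    then obtain i where i: "1 \<le> i" "i \<le> int n - 1" "s \<in> {(i, 0), (0, i), (i, i)}"
      by (auto simp: conn_set_def)
    have "(- i) mod int n = int n - i"
      using i by (simp add: zmod_zminus1_eq_if)
    then have "inv\<^bsub>Zn_square n\<^esub> s \<in> {(int n - i, 0), (0, int n - i), (int n - i, int n - i)}"
      using i assms
      by (auto simp: Zn_square_def inv_DirProd carrier_integer_mod_group)
    with i show "inv\<^bsub>Zn_square n\<^esub> s \<in> conn_set n"
      unfolding conn_set_def by (intro UN_I[of "int n - i"]) auto
  qed
qed

end

theory Submission
  imports Defs
begin

text \<open>
  An automorphism moving \<open>(u, v)\<close> to \<open>(x, y)\<close> maps the subgraph induced on the common
  neighbours of \<open>u\<close> and \<open>v\<close> isomorphically onto the one of \<open>x\<close> and \<open>y\<close>, so it is enough to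
  exhibit two pairs at the same distance for which the degrees in these subgraphs differ.

  Let \<open>(a, b)\<close> be non-adjacent to the origin. It has six common neighbours with the origin,
  forming a hexagon, whose long diagonals are edges precisely when \<open>a + b = 0\<close>, \<open>a = 2 b\<close> or
  \<open>b = 2 a\<close>, respectively. For \<open>n \<ge> 6\<close> the point \<open>(1, 2)\<close> yields a diagonal and \<open>(1, 3)\<close>
  does not. For \<open>n = 4\<close> all these hexagons have exactly one diagonal; there the adjacent pairs
  formed by the origin with \<open>(2, 0)\<close> and with \<open>(1, 0)\<close> are told apart, as only the latter has an
  isolated common neighbour.
\<close>

text \<open>Under unit weights the cost of a walk is its length, so a shortest walk attains the
  infimum that defines the distance.\<close>

lemma graph_dist_eqI:
  assumes "wf_digraph \<Gamma>" "pre_digraph.awalk \<Gamma> u p v"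
    and "\<And>q. pre_digraph.awalk \<Gamma> u q v \<Longrightarrow> length p \<le> length q"
  shows "graph_dist \<Gamma> u v = length p"
proof -
  interpret wf_digraph \<Gamma> by fact
  have "awalk_cost (\<lambda>_. 1) q = length q" for q
    by (induction q) auto
  then show ?thesis
    unfolding graph_dist_def \<mu>_def
    by (intro antisym) (use assms(2,3) in \<open>auto intro!: INF_lower2 INF_greatest\<close>)
qed

lemma graph_dist_adjacent:
  assumes "wf_digraph (with_proj P)" "(u, v) \<in> parcs P" "u \<noteq> v"
  shows "graph_dist (with_proj P) u v = 1"
proof -
  interpret wf_digraph "with_proj P" by fact
  have "u \<in> pverts P" "v \<in> pverts P"
    using tail_in_verts head_in_verts assms(2) by fastforce+
  then have "graph_dist (with_proj P) u v = length [(u, v)]"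
  proof (intro graph_dist_eqI)
    show "length [(u, v)] \<le> length q" if "awalk u q v" for q
      using that assms(3) by (cases q) (auto simp: awalk_Nil_iff)
  qed (use assms in \<open>auto simp: awalk_simps wf_digraph_axioms\<close>)
  then show ?thesis by (simp add: one_ereal_def)
qed

lemma graph_dist_common_neighbour:
  assumes "wf_digraph (with_proj P)" "(u, w) \<in> parcs P" "(w, v) \<in> parcs P"
    and "(u, v) \<notin> parcs P" "u \<noteq> v"
  shows "graph_dist (with_proj P) u v = 2"
proof -
  interpret wf_digraph "with_proj P" by fact
  have "u \<in> pverts P" "w \<in> pverts P" "v \<in> pverts P"
    using tail_in_verts head_in_verts assms(2,3) by fastforce+
  then have "graph_dist (with_proj P) u v = length [(u, w), (w, v)]"
  proof (intro graph_dist_eqI)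
    show "length [(u, w), (w, v)] \<le> length q" if "awalk u q v" for q
    \<comment> \<open>This case rule separates empty, one-element and longer lists; the first two
      would force \<open>u = v\<close> or an arc from \<open>u\<close> to \<open>v\<close>.\<close>
    proof (cases q rule: remdups_adj.cases)
      case (2 e)
      then show ?thesis
        using that assms(4) by (cases e) (auto simp: awalk_simps)
    qed (use that assms(5) in \<open>auto simp: awalk_Nil_iff\<close>)
  qed (use assms in \<open>auto simp: awalk_simps wf_digraph_axioms\<close>)
  then show ?thesis by simp
qed

definition common_neighbours :: "'a pair_pre_digraph \<Rightarrow> 'a \<Rightarrow> 'a \<Rightarrow> 'a set" where
  "common_neighbours P u v = {w \<in> pverts P. (u, w) \<in> parcs P \<and> (v, w) \<in> parcs P}"

definition local_degree :: "'a pair_pre_digraph \<Rightarrow> 'a \<Rightarrow> 'a \<Rightarrow> 'a \<Rightarrow> nat" where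
  "local_degree P u v c = card {d \<in> common_neighbours P u v. (c, d) \<in> parcs P}"

text \<open>Lower bounds can thus be certified by exhibited neighbours, without determining all
  common neighbours.\<close>

lemma card_le_local_degree:
  assumes "finite (pverts P)" "D \<subseteq> {d \<in> common_neighbours P u v. (c, d) \<in> parcs P}"
  shows "card D \<le> local_degree P u v c"
  unfolding local_degree_def using assms by (intro card_mono) (simp_all add: common_neighbours_def)

text \<open>The position of \<open>c'\<close> is unknown, so applications have to rule out the
  degree of \<open>c\<close> at every common neighbour of \<open>x\<close> and
  \<open>y\<close>.\<close>

lemma distance_transitive_local_degree:
  assumes "distance_transitive (with_proj P)" "wf_digraph (with_proj P)"
    and uv: "u \<in> pverts P" "v \<in> pverts P" and xy: "x \<in> pverts P" "y \<in> pverts P"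
    and "graph_dist (with_proj P) u v = graph_dist (with_proj P) x y"
    and c: "c \<in> common_neighbours P u v"
  obtains c' where "c' \<in> common_neighbours P x y" "local_degree P x y c' = local_degree P u v c"
proof -
  obtain \<pi> where "digraph_automorphism (with_proj P) \<pi>"
    and \<pi>: "iso_verts \<pi> u = x" "iso_verts \<pi> v = y"
    using assms unfolding distance_transitive_def with_proj_simps by blast
  then obtain f where f: "x = f u" "y = f v"
    and bij: "bij_betw f (pverts P) (pverts P)"
    and adj: "\<And>u v. u \<in> pverts P \<Longrightarrow> v \<in> pverts P \<Longrightarrow> (f u, f v) \<in> parcs P \<longleftrightarrow> (u, v) \<in> parcs P"
    using digraph_automorphism_with_proj[OF assms(2), of "iso_verts \<pi>"] by metis
  have fV: "f w \<in> pverts P" if "w \<in> pverts P" for w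
    using bij that by (auto simp: bij_betw_def)
  have CN: "f w \<in> common_neighbours P x y \<longleftrightarrow> w \<in> common_neighbours P u v" if "w \<in> pverts P" for w
    using that uv fV unfolding f common_neighbours_def by (simp add: adj)
  have cV: "c \<in> pverts P" using c by (simp add: common_neighbours_def)
  have "{d \<in> common_neighbours P x y. (f c, d) \<in> parcs P} =
      f ` {d \<in> common_neighbours P u v. (c, d) \<in> parcs P}" (is "?R = f ` ?L")
  proof
    show "f ` ?L \<subseteq> ?R"
    proof
      fix d assume "d \<in> f ` ?L"
      then obtain e where "d = f e" "e \<in> ?L" by blast
      moreover from this have "e \<in> pverts P" by (simp add: common_neighbours_def)
      ultimately show "d \<in> ?R" using cV by (simp add: CN adj)
    qed
    show "?R \<subseteq> f ` ?L"
    proof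
      fix d assume d: "d \<in> ?R"
      then have "d \<in> f ` pverts P"
        using bij by (simp add: bij_betw_def common_neighbours_def)
      then obtain e where "e \<in> pverts P" "d = f e" by blast
      with d cV show "d \<in> f ` ?L" by (simp add: CN adj)
    qed
  qed
  moreover have "inj_on f ?L"
    using bij by (auto simp: bij_betw_def common_neighbours_def intro: inj_on_subset)
  ultimately have "local_degree P x y (f c) = local_degree P u v c"
    by (simp add: local_degree_def card_image)
  moreover have "f c \<in> common_neighbours P x y"
    using c cV by (simp add: CN)
  ultimately show thesis by (rule that[rotated])
qed

text \<open>Explicit coordinates turn adjacency into linear arithmetic. Since
  \<open>a - b - c + d\<close> lies strictly between \<open>-2n\<close> and \<open>2n\<close>, the
  three listed values are the only multiples of \<open>n\<close> it can take; they express a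
  difference on the diagonal.\<close>

definition Gamma_pair :: "nat \<Rightarrow> (int \<times> int) pair_pre_digraph" where
  "Gamma_pair n = \<lparr>pverts = {0..<int n} \<times> {0..<int n},
    parcs = {((a, b), (c, d)). {a, b, c, d} \<subseteq> {0..<int n} \<and> (a, b) \<noteq> (c, d) \<and>
      (a = c \<or> b = d \<or> a - b - c + d \<in> {0, int n, - int n})}\<rparr>"

lemma adjacent_Gamma_pair:
  "((a, b), (c, d)) \<in> parcs (Gamma_pair n) \<longleftrightarrow>
    0 \<le> a \<and> a < int n \<and> 0 \<le> b \<and> b < int n \<and> 0 \<le> c \<and> c < int n \<and> 0 \<le> d \<and> d < int n \<and>
    \<not> (a = c \<and> b = d) \<and>
    (a = c \<or> b = d \<or> a - b - c + d = 0 \<or> a - b - c + d = int n \<or> a - b - c + d = - int n)"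
  by (auto simp: Gamma_pair_def)

lemma common_neighbours_Gamma_pair:
  "w \<in> common_neighbours (Gamma_pair n) u v \<longleftrightarrow>
    (u, w) \<in> parcs (Gamma_pair n) \<and> (v, w) \<in> parcs (Gamma_pair n)"
  by (cases u; cases v; cases w) (auto simp: common_neighbours_def Gamma_pair_def)

lemma Gamma_eq:
  assumes "0 < n"
  shows "Gamma n = with_proj (Gamma_pair n)"
proof -
  \<comment> \<open>The left side is what a product with an inverse unfolds to in
    \<open>integer_mod_group n\<close>; a difference of representatives wraps around at most
    once.\<close>
  have diff: "(c + - a mod int n) mod int n = (if a \<le> c then c - a else c - a + int n)"
    if "a \<in> {0..<int n}" "c \<in> {0..<int n}" for a c
  proof -
    have "(c + - a mod int n) mod int n = (c - a) mod int n"
      by (simp add: mod_simps)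
    also have "\<dots> = (if a \<le> c then c - a else c - a + int n)"
    proof (cases "a \<le> c")
      case False
      have "(c - a) mod int n = (c - a + int n) mod int n" by simp
      also have "\<dots> = c - a + int n" using that False by (intro mod_pos_pos_trivial) auto
      finally show ?thesis using False by simp
    qed (use that in auto)
    finally show ?thesis .
  qed
  have conn: "(i, j) \<in> conn_set n \<longleftrightarrow>
      {i, j} \<subseteq> {0..<int n} \<and> (i, j) \<noteq> (0, 0) \<and> (i = 0 \<or> j = 0 \<or> i = j)" for i j
    by (auto simp: conn_set_def)
  have "((c, d) \<otimes>\<^bsub>Zn_square n\<^esub> inv\<^bsub>Zn_square n\<^esub> (a, b) \<in> conn_set n) \<longleftrightarrow>
      ((a, b), (c, d)) \<in> parcs (Gamma_pair n)"
    if ranges: "a \<in> {0..<int n}" "b \<in> {0..<int n}" "c \<in> {0..<int n}" "d \<in> {0..<int n}" for a b c d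
  proof -
    have "(c, d) \<otimes>\<^bsub>Zn_square n\<^esub> inv\<^bsub>Zn_square n\<^esub> (a, b) =
        (if a \<le> c then c - a else c - a + int n, if b \<le> d then d - b else d - b + int n)"
      using ranges assms diff by (simp add: Zn_square_def carrier_integer_mod_group inv_DirProd)
    then show ?thesis
      using ranges unfolding adjacent_Gamma_pair conn by (simp add: conn) linarith
  qed
  moreover have "carrier (Zn_square n) = {0..<int n} \<times> {0..<int n}"
    using assms by (simp add: Zn_square_def DirProd_def carrier_integer_mod_group)
  moreover have "parcs (Gamma_pair n) \<subseteq> ({0..<int n} \<times> {0..<int n}) \<times> ({0..<int n} \<times> {0..<int n})"
    by (auto simp: Gamma_pair_def)
  ultimately have "{(g, h). g \<in> carrier (Zn_square n) \<and> h \<in> carrier (Zn_square n) \<and>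
      h \<otimes>\<^bsub>Zn_square n\<^esub> inv\<^bsub>Zn_square n\<^esub> g \<in> conn_set n} = parcs (Gamma_pair n)"
    by (auto simp: subset_iff)
  then show ?thesis
    unfolding Gamma_def cayley_graph_def
    using \<open>carrier (Zn_square n) = _\<close> by (simp add: Gamma_pair_def)
qed

theorem theorem3p3:
  fixes n :: nat
  assumes "n \<ge> 4" and "n \<noteq> 5"
  shows "\<not> distance_transitive (Gamma n)"
proof
  assume dt: "distance_transitive (Gamma n)"
  let ?P = "Gamma_pair n"
  have wf: "wf_digraph (with_proj ?P)"
    by unfold_locales (auto simp: Gamma_pair_def)
  have fin: "finite (pverts ?P)"
    by (simp add: Gamma_pair_def)
  have Geq: "Gamma n = with_proj ?P"
    using assms by (intro Gamma_eq) simp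
  note ld = distance_transitive_local_degree[OF dt[unfolded Geq] wf]
  show False
  proof (cases "n = 4")
    case True
    have dist: "graph_dist (with_proj ?P) (0, 0) (a, 0) = 1" if "a \<in> {1, 2}" for a
      by (rule graph_dist_adjacent[OF wf]) (use that True in \<open>auto simp: adjacent_Gamma_pair\<close>)
    have c: "(1, 1) \<in> common_neighbours ?P (0, 0) (1, 0)"
      using True by (simp add: common_neighbours_Gamma_pair adjacent_Gamma_pair)
    obtain c' where c': "c' \<in> common_neighbours ?P (0, 0) (2, 0)"
      "local_degree ?P (0, 0) (2, 0) c' = local_degree ?P (0, 0) (1, 0) (1, 1)"
      by (rule ld[OF _ _ _ _ _ c, of "(0, 0)" "(2, 0)"])
        (use True dist in \<open>auto simp: Gamma_pair_def\<close>)
    \<comment> \<open>The other common neighbours are \<open>(2, 0)\<close>, \<open>(3, 0)\<close>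
      and \<open>(0, 3)\<close>; modulo 4 they differ from \<open>(1, 1)\<close> by
      \<open>(1, 3)\<close>, \<open>(2, 3)\<close> and \<open>(3, 2)\<close>, none of which is in
      \<open>conn_set 4\<close>.\<close>
    have isolated: "{d \<in> common_neighbours ?P (0, 0) (1, 0). ((1, 1), d) \<in> parcs ?P} = {}"
      unfolding common_neighbours_Gamma_pair using True
      by (auto simp: adjacent_Gamma_pair)
    have isolated_deg: "local_degree ?P (0, 0) (1, 0) (1, 1) = 0"
      unfolding local_degree_def isolated by simp
    have c'_in: "c' \<in> {(1, 0), (3, 0), (0, 2), (2, 2)}"
    proof (cases c')
      case (Pair p q)
      then have "p \<in> {0..3}" "q \<in> {0..3}"
        using c'(1) True by (auto simp: common_neighbours_Gamma_pair adjacent_Gamma_pair)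
      then have "p \<in> {0, 1, 2, 3}" "q \<in> {0, 1, 2, 3}" by auto
      then show ?thesis
        using c'(1) True unfolding common_neighbours_Gamma_pair Pair
        by (elim insertE emptyE; simp add: adjacent_Gamma_pair)
    qed
    \<comment> \<open>The singleton holds the partner of \<open>c'\<close> in the perfect matching
      with edges \<open>(1, 0)\<close>-\<open>(3, 0)\<close> and
      \<open>(0, 2)\<close>-\<open>(2, 2)\<close>.\<close>
    have "card {if c' = (1, 0) then (3 :: int, 0 :: int) else if c' = (3, 0) then (1, 0)
        else if c' = (0, 2) then (2, 2) else (0, 2)} \<le> local_degree ?P (0, 0) (2, 0) c'"
      using c'_in True
      by (intro card_le_local_degree[OF fin])
        (auto simp: common_neighbours_Gamma_pair adjacent_Gamma_pair)
    with isolated_deg show False using c'(2) by simp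
  next
    case False
    then have n: "6 \<le> n" using assms by simp
    have dist: "graph_dist (with_proj ?P) (0, 0) (1, b) = 2" if "b \<in> {2, 3}" for b
      by (rule graph_dist_common_neighbour[OF wf, of _ "(1, 0)"])
        (use that n in \<open>auto simp: adjacent_Gamma_pair\<close>)
    have c: "(0, 1) \<in> common_neighbours ?P (0, 0) (1, 2)"
      using n by (simp add: common_neighbours_Gamma_pair adjacent_Gamma_pair)
    obtain c' where c': "c' \<in> common_neighbours ?P (0, 0) (1, 3)"
      "local_degree ?P (0, 0) (1, 3) c' = local_degree ?P (0, 0) (1, 2) (0, 1)"
      by (rule ld[OF _ _ _ _ _ c, of "(0, 0)" "(1, 3)"])
        (use n dist in \<open>auto simp: Gamma_pair_def\<close>)
    \<comment> \<open>On the hexagon \<open>(0, 1)\<close> lies between \<open>(0, 2)\<close> and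
      \<open>(int n - 1, 0)\<close>; the long diagonal to \<open>(1, 1)\<close> comes from
      \<open>b = 2 a\<close>.\<close>
    have "card {(1, 1), (0, 2), (int n - 1, 0 :: int)} \<le> local_degree ?P (0, 0) (1, 2) (0, 1)"
      using n by (intro card_le_local_degree[OF fin])
        (simp add: common_neighbours_Gamma_pair adjacent_Gamma_pair)
    moreover have "local_degree ?P (0, 0) (1, 3) c' \<le> 2"
    proof -
      have hexagon: "d \<in> {(1, 0), (int n - 2, 0), (0, 3), (0, 2), (1, 1), (3, 3)}"
        if "d \<in> common_neighbours ?P (0, 0) (1, 3)" for d
      proof (cases d)
        case (Pair p q)
        then have adj: "((0, 0), (p, q)) \<in> parcs ?P" "((1, 3), (p, q)) \<in> parcs ?P"
          using that by (simp_all add: common_neighbours_Gamma_pair)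
        \<comment> \<open>A neighbour of the origin lies on one of three lines; on each, adjacency
          to \<open>(1, 3)\<close> leaves two points.\<close>
        then have "p = 0 \<or> q = 0 \<or> p = q"
          unfolding adjacent_Gamma_pair by linarith
        then show ?thesis
          using adj(2) n unfolding Pair adjacent_Gamma_pair by (elim disjE) auto
      qed
      have "{d \<in> common_neighbours ?P (0, 0) (1, 3). (c', d) \<in> parcs ?P} \<subseteq>
          {d \<in> {(1, 0), (int n - 2, 0), (0, 3), (0, 2), (1, 1), (3, 3)}. (c', d) \<in> parcs ?P}"
        using hexagon by blast
      \<comment> \<open>The cyclic order is \<open>(1, 0)\<close>, \<open>(int n - 2, 0)\<close>,
        \<open>(0, 2)\<close>, \<open>(0, 3)\<close>, \<open>(3, 3)\<close>, \<open>(1, 1)\<close>,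
        and each branch lists the two cyclic neighbours of \<open>c'\<close>. The long diagonals
        would require \<open>n\<close> to divide 4, 5 or 1, which \<open>n \<ge> 6\<close>
        excludes.\<close>
      also have "\<dots> \<subseteq>
         (if c' = (1, 0) then {(int n - 2, 0), (1, 1)}
          else if c' = (int n - 2, 0) then {(1, 0), (0, 2)}
          else if c' = (0, 3) then {(0, 2), (3, 3)}
          else if c' = (0, 2) then {(0, 3), (int n - 2, 0)}
          else if c' = (1, 1) then {(3, 3), (1, 0)}
          else {(1, 1), (0, 3)})"
        using hexagon[OF c'(1)] n by (elim insertE emptyE; auto simp: adjacent_Gamma_pair)
      finally have "local_degree ?P (0, 0) (1, 3) c' \<le> card \<dots>"
        unfolding local_degree_def by (intro card_mono) auto
      also have "\<dots> \<le> 2" by (simp add: card_insert_if)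
      finally show ?thesis .
    qed
    ultimately show False using c'(2) n by simp
  qed
qed

end
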